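(* Let $\{e_n\}_{n=1}^{\infty}$ be a Riesz basis of a Hilbert space $H$, let $k\in\mathbb{N}$, and let $H_k(\{e_n\})$ be the associated Hilbert space of formal series (defined in the context). Suppose that $\{A_n\}_{n=1}^{\infty}$ is an arbitrary decomposition of $\mathbb{N}$ into disjoint sets, i.e. $\mathbb{N}=\bigcup_{n=1}^{\infty}A_n$ and $A_n\cap A_m=\emptyset$ for $n\neq m$. Then $\left\{\overline{\mathrm{Lin}}\,\{e_j\}_{j\in A_n}\right\}_{n=1}^{\infty}$ (closed linear spans taken in $H_k(\{e_n\})$) does not form a Schauder decomposition of $H_k(\{e_n\})$.
   Context: $\mathbb{N}=\{1,2,3,\dots\}$. The difference operator $\Delta$ acts on scalar sequences by $(\Delta c)_n=c_n-c_{n-1}$, $n\ge 1$, with the convention $c_0=0$; $\Delta^k$ is its $k$-th power, so $(\Delta^k c)_n=\sum_{j=0}^{k}(-1)^j\binom{k}{j}c_{n-j}$ with $c_{m}=0$ for $m\le 0$. Put $\ell_2(\Delta^k)=\{\{c_n\}_{n=1}^{\infty}: \Delta^k\{c_n\}_{n=1}^\infty\in\ell_2\}$. For a Riesz basis $\{e_n\}_{n=1}^\infty$ of a Hilbert space $H$ with norm $\|\cdot\|$, $H_k(\{e_n\})$ is the space of formal series $x=(\mathfrak{f})\sum_{n=1}^{\infty}c_ne_n$ (identified with their coefficient sequences) with $\{c_n\}_{n=1}^\infty\in\ell_2(\Delta^k)$, with norm $\|x\|_k=\left\|\sum_{n=1}^{\infty}(\Delta^k c)_n e_n\right\|$, the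 latter series converging in $H$. It is a separable Hilbert space. The vector $e_j$ is regarded as the element of $H_k(\{e_n\})$ whose coefficient sequence is $1$ at position $j$ and $0$ elsewhere. A sequence $\{\mathfrak{M}_n\}_{n=1}^\infty$ of closed subspaces of a Banach space $X$ is a Schauder decomposition of $X$ if every $x\in X$ can be uniquely represented as a norm-convergent series $x=\sum_{n=1}^\infty x_n$ with $x_n\in\mathfrak{M}_n$ for each $n$.
   Formalization: The sets A_n are additionally assumed to be nonempty; if empty sets were allowed, A_1 = N with all other A_n empty would give the trivial Schauder decomposition H_k, {0}, {0}, ..., so the claim would fail. *)

theory Defs
  imports "HOL-Analysis.Analysis" "HOL-Library.Function_Algebras"
begin

text \<open>Real and complex Hilbert spaces are treated together: the scalars form a complete
  normed field with a conjugation, the instances being the real and the complex numbers.\<close>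

class rc_scalar = real_normed_field + banach +
  fixes conjg :: "'a \<Rightarrow> 'a"
  assumes conjg_add: "conjg (x + y) = conjg x + conjg y"
    and conjg_mult: "conjg (x * y) = conjg x * conjg y"
    and conjg_scaleR: "conjg (r *\<^sub>R x) = r *\<^sub>R conjg x"
    and conjg_conjg: "conjg (conjg x) = x"
    and mult_conjg: "x * conjg x = (norm x)\<^sup>2 *\<^sub>R 1"

instantiation real :: rc_scalar
begin
definition conjg_real :: "real \<Rightarrow> real" where "conjg_real x = x"
instance by standard (simp_all add: conjg_real_def power2_eq_square)
end

instantiation complex :: rc_scalar
begin
definition conjg_complex :: "complex \<Rightarrow> complex" where "conjg_complex = cnj"
instance
proof
  fix x :: complex
  show "x * conjg x = (norm x)\<^sup>2 *\<^sub>R 1"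
    by (metis complex_norm_square conjg_complex_def mult.right_neutral scaleR_conv_of_real)
qed (simp_all add: conjg_complex_def)
end

text \<open>Completeness is part of the class \<^class>\<open>banach\<close>. The last axiom says that the norm
  of that class is the norm of the inner product, and it makes the inner product
  positive definite.\<close>

locale hilbert_space = vector_space smul
  for smul :: "'k::rc_scalar \<Rightarrow> 'h::banach \<Rightarrow> 'h" +
  fixes ip :: "'h \<Rightarrow> 'h \<Rightarrow> 'k"
  assumes smul_of_real: "smul (of_real r) x = r *\<^sub>R x"
    and ip_add_left: "ip (x + y) z = ip x z + ip y z"
    and ip_smul_left: "ip (smul a x) y = a * ip x y"
    and ip_conjg: "ip y x = conjg (ip x y)"
    and ip_self: "ip x x = of_real ((norm x)\<^sup>2)"
begin

definition orthonormal_basis :: "(nat \<Rightarrow> 'h) \<Rightarrow> bool" where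
  "orthonormal_basis f \<longleftrightarrow>
     (\<forall>m n. ip (f m) (f n) = (if m = n then 1 else 0)) \<and> closure (span (range f)) = UNIV"

text \<open>A Riesz basis is the image of an orthonormal basis under a bounded linear operator
  with bounded inverse. As \<^const>\<open>bounded_linear\<close> speaks of real scalars only,
  homogeneity over the scalar field is stated separately.\<close>

definition riesz_basis :: "(nat \<Rightarrow> 'h) \<Rightarrow> bool" where
  "riesz_basis e \<longleftrightarrow>
     (\<exists>f T. orthonormal_basis f \<and> bounded_linear T \<and> (\<forall>a x. T (smul a x) = smul a (T x)) \<and>
        bij T \<and> bounded_linear (inv T) \<and> (\<forall>n. e n = T (f n)))"

end

text \<open>A sequence indexed by the positive integers is a function on \<^typ>\<open>nat\<close>, the argument
  \<open>n\<close> standing for the position \<open>n + 1\<close>; the convention that the term before the first one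
  is zero becomes a case distinction.\<close>

definition delta :: "(nat \<Rightarrow> 'k::rc_scalar) \<Rightarrow> nat \<Rightarrow> 'k" where
  "delta c n = c n - (if n = 0 then 0 else c (n - 1))"

definition ell2 :: "(nat \<Rightarrow> 'k::rc_scalar) set" where
  "ell2 = {c. summable (\<lambda>n. (norm (c n))\<^sup>2)}"

definition ell2_delta :: "nat \<Rightarrow> (nat \<Rightarrow> 'k::rc_scalar) set" where
  "ell2_delta k = {c. (delta ^^ k) c \<in> ell2}"

text \<open>The space of formal series has carrier \<^term>\<open>ell2_delta k\<close>, a formal series being its
  coefficient sequence, with pointwise addition and scalar multiplication \<open>seq_scale\<close>.
  The basis \<open>e\<close> enters only through the norm.\<close>

definition seq_scale :: "'k::rc_scalar \<Rightarrow> (nat \<Rightarrow> 'k) \<Rightarrow> nat \<Rightarrow> 'k" where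
  "seq_scale a c = (\<lambda>n. a * c n)"

definition series_norm ::
    "('k::rc_scalar \<Rightarrow> 'h::banach \<Rightarrow> 'h) \<Rightarrow> (nat \<Rightarrow> 'h) \<Rightarrow> nat \<Rightarrow> (nat \<Rightarrow> 'k) \<Rightarrow> real" where
  "series_norm smul e k c = norm (\<Sum>n. smul ((delta ^^ k) c n) (e n))"

definition unit_seq :: "nat \<Rightarrow> nat \<Rightarrow> 'k::rc_scalar" where
  "unit_seq j = (\<lambda>n. if n = j then 1 else 0)"

text \<open>Normed spaces given by a carrier \<open>X\<close> and a norm \<open>nrm\<close> on it.\<close>

definition norm_topology :: "'v::ab_group_add set \<Rightarrow> ('v \<Rightarrow> real) \<Rightarrow> 'v topology" where
  "norm_topology X nrm = Metric_space.mtopology X (\<lambda>x y. nrm (x - y))"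

definition closed_lin ::
    "('k::rc_scalar \<Rightarrow> 'v::ab_group_add \<Rightarrow> 'v) \<Rightarrow> 'v set \<Rightarrow> ('v \<Rightarrow> real) \<Rightarrow> 'v set \<Rightarrow> 'v set" where
  "closed_lin sc X nrm S = norm_topology X nrm closure_of (module.span sc S)"

definition schauder_decomposition ::
    "('k::rc_scalar \<Rightarrow> 'v::ab_group_add \<Rightarrow> 'v) \<Rightarrow> 'v set \<Rightarrow> ('v \<Rightarrow> real) \<Rightarrow> (nat \<Rightarrow> 'v set) \<Rightarrow> bool"
  where
  "schauder_decomposition sc X nrm M \<longleftrightarrow>
     (\<forall>n. module.subspace sc (M n) \<and> closedin (norm_topology X nrm) (M n)) \<and>
     (\<forall>x\<in>X. \<exists>!y. (\<forall>n. y n \<in> M n) \<and>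
        limitin (norm_topology X nrm) (\<lambda>N. \<Sum>n<N. y n) x sequentially)"

end

theory Submission imports Defs begin

text \<open>Convergence in the series norm forces coordinatewise convergence, so a decomposition of the
  constant sequence \<open>1\<close> along the sets \<open>A n\<close> can only consist of the indicators of these sets.
  The remainders are then nonzero sequences with values in \<open>{0, 1}\<close>. Their \<open>k\<close>-th
  differences are nonzero integer sequences, hence have an entry of modulus at least \<open>1\<close>, and the
  remainders stay away from zero in norm.\<close>

section \<open>The difference operator and its powers\<close>

lemma delta_add: "delta (c + d) = delta c + delta d"
  by (auto simp: delta_def fun_eq_iff)

lemma delta_diff: "delta (c - d) = delta c - delta d"
  by (auto simp: delta_def fun_eq_iff)

lemma funpow_delta_add: "(delta ^^ k) (c + d) = (delta ^^ k) c + (delta ^^ k) d"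
  by (induction k) (simp_all only: funpow.simps comp_apply id_apply delta_add)

lemma funpow_delta_diff: "(delta ^^ k) (c - d) = (delta ^^ k) c - (delta ^^ k) d"
  by (induction k) (simp_all only: funpow.simps comp_apply id_apply delta_diff)

text \<open>Each term is its difference plus the preceding term, so limits of the differences add up
  along \<open>n\<close>.\<close>

lemma tendsto_of_delta:
  assumes "\<And>n. ((\<lambda>i. delta (c i) n) \<longlongrightarrow> delta x n) F"
  shows "((\<lambda>i. c i n) \<longlongrightarrow> x n) F"
proof (induction n)
  case 0
  show ?case using assms[of 0] by (simp add: delta_def)
next
  case (Suc n)
  show ?case using tendsto_add[OF assms[of "Suc n"] Suc] by (simp add: delta_def)
qed

lemma tendsto_of_funpow_delta:
  assumes "\<And>n. ((\<lambda>i. (delta ^^ k) (c i) n) \<longlongrightarrow> (delta ^^ k) x n) F"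
  shows "((\<lambda>i. c i n) \<longlongrightarrow> x n) F"
  using assms
proof (induction k arbitrary: n)
  case 0
  then show ?case by simp
next
  case (Suc k)
  have "((\<lambda>i. (delta ^^ k) (c i) n) \<longlongrightarrow> (delta ^^ k) x n) F" for n
    by (rule tendsto_of_delta) (use Suc.prems in simp)
  then show ?case by (rule Suc.IH)
qed

text \<open>A sequence consists of the partial sums of its differences and is therefore determined
  by them.\<close>

lemma inj_delta: "inj delta"
proof (rule injI)
  fix c d :: "nat \<Rightarrow> 'k::rc_scalar"
  assume eq: "delta c = delta d"
  have "c n = d n" for n
  proof (induction n)
    case 0
    show ?case using fun_cong[OF eq, of 0] by (simp add: delta_def)
  next
    case (Suc n)
    then show ?case using fun_cong[OF eq, of "Suc n"] by (simp add: delta_def)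
  qed
  then show "c = d" by blast
qed

lemma inj_funpow_delta: "inj (delta ^^ k)"
  by (rule inj_fn[OF inj_delta])

lemma funpow_delta_0: "(delta ^^ k) 0 = 0"
  using funpow_delta_diff[of k 0 0] by simp

lemma funpow_delta_Ints:
  assumes "\<And>n. c n \<in> \<int>"
  shows "(delta ^^ k) c n \<in> \<int>"
  using assms by (induction k arbitrary: n) (auto simp: delta_def)

lemma norm_Ints_ge_1:
  fixes x :: "'a::real_normed_algebra_1"
  assumes "x \<in> \<int>" "x \<noteq> 0"
  shows "1 \<le> norm x"
proof -
  obtain z where z: "x = of_int z" using assms(1) by (auto elim: Ints_cases)
  with assms(2) have "z \<noteq> 0" by auto
  then have "1 \<le> \<bar>z\<bar>" by simp
  then show ?thesis unfolding z norm_of_int by linarith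
qed

section \<open>Square-summable sequences\<close>

lemma ell2_add:
  assumes "c \<in> ell2" "d \<in> ell2"
  shows "c + d \<in> ell2"
proof -
  have "summable (\<lambda>n. 2 * (norm (c n))\<^sup>2 + 2 * (norm (d n))\<^sup>2)"
    using assms by (intro summable_add summable_mult) (auto simp: ell2_def)
  moreover have "(norm (c n + d n))\<^sup>2 \<le> 2 * (norm (c n))\<^sup>2 + 2 * (norm (d n))\<^sup>2" for n
  proof -
    have "(norm (c n + d n))\<^sup>2 \<le> (norm (c n) + norm (d n))\<^sup>2"
      by (intro power_mono norm_triangle_ineq) simp
    also have "\<dots> \<le> 2 * (norm (c n))\<^sup>2 + 2 * (norm (d n))\<^sup>2"
      using sum_squares_bound[of "norm (c n)" "norm (d n)"]
      by (simp add: power2_sum)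
    finally show ?thesis .
  qed
  ultimately show ?thesis
    unfolding ell2_def by (auto intro: summable_comparison_test')
qed

lemma ell2_diff:
  assumes "c \<in> ell2" "d \<in> ell2"
  shows "c - d \<in> ell2"
proof -
  have "- d \<in> ell2" using assms(2) by (simp add: ell2_def)
  from ell2_add[OF assms(1) this] show ?thesis by simp
qed

lemma ell2_delta_diff:
  "c \<in> ell2_delta k \<Longrightarrow> d \<in> ell2_delta k \<Longrightarrow> c - d \<in> ell2_delta k"
  by (simp add: ell2_delta_def funpow_delta_diff ell2_diff)

text \<open>The first difference of the constant is the unit sequence at \<open>0\<close>, and every
  further difference extends the support by at most one index. The support is thus finite as soon as
  at least one difference is taken.\<close>

lemma const_1_in_ell2_delta:
  assumes "k \<ge> 1"
  shows "(\<lambda>_. 1 :: 'k::rc_scalar) \<in> ell2_delta k"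
proof -
  \<comment> \<open>The induction has to start at the first difference, hence \<open>Suc k\<close>.
    This local \<open>k\<close> shadows that of the lemma, which is recovered by the instance
    \<open>k - 1\<close>.\<close>
  have "\<forall>n\<ge>Suc k. (delta ^^ Suc k) (\<lambda>_. 1 :: 'k) n = 0" for k
    by (induction k) (auto simp: delta_def)
  from this[of "k - 1"] assms have *: "\<forall>n\<ge>k. (delta ^^ k) (\<lambda>_. 1 :: 'k) n = 0"
    by simp
  have "summable (\<lambda>n. (norm ((delta ^^ k) (\<lambda>_. 1 :: 'k) n))\<^sup>2)"
    by (rule summable_finite[of "{..<k}"]) (use * in auto)
  then show ?thesis by (simp add: ell2_delta_def ell2_def)
qed

lemma conjg_0 [simp]: "conjg (0 :: 'k::rc_scalar) = 0"
  using conjg_scaleR[of 0 "0 :: 'k"] by simp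

text \<open>The locale \<open>Metric_space\<close> demands symmetry also outside the carrier, where
  the series may diverge and \<open>suminf\<close> is an unspecified value, the same for a series and its
  negative.\<close>

lemma norm_suminf_minus: "norm (\<Sum>n. - u n) = norm (\<Sum>n. u n :: 'x::real_normed_vector)"
proof (cases "summable u")
  case True
  then show ?thesis by (simp add: suminf_minus)
next
  case False
  then have "\<not> summable (\<lambda>n. - u n)" by (simp add: summable_minus_iff)
  with False have "(sums) (\<lambda>n. - u n) = (sums) u" by (auto simp: summable_def)
  then show ?thesis by (simp add: suminf_def)
qed

section \<open>Expansions along orthonormal and Riesz bases\<close>

context hilbert_space
begin

lemma ip_0_left [simp]: "ip 0 y = 0"
  using ip_add_left[of 0 0 y] by simp

lemma ip_add_right: "ip x (y + z) = ip x y + ip x z"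
  by (metis conjg_add ip_add_left ip_conjg)

lemma ip_smul_right: "ip x (smul a y) = conjg a * ip x y"
  by (metis conjg_mult ip_smul_left ip_conjg)

lemma norm_add_orthogonal:
  assumes "ip x y = 0"
  shows "(norm (x + y))\<^sup>2 = (norm x)\<^sup>2 + (norm y)\<^sup>2"
proof -
  have "ip y x = 0" using assms ip_conjg[of y x] by simp
  then have "ip (x + y) (x + y) = ip x x + ip y y"
    using assms by (simp add: ip_add_left ip_add_right)
  then have "(of_real ((norm (x + y))\<^sup>2) :: 'k) = of_real ((norm x)\<^sup>2 + (norm y)\<^sup>2)"
    by (simp only: ip_self of_real_add)
  then show ?thesis by (simp only: of_real_eq_iff)
qed

text \<open>The class \<open>banach\<close> gives homogeneity for real scalars only; for scalars in
  \<open>'k\<close> it comes from the inner product and \<open>mult_conjg\<close>.\<close>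

lemma norm_smul: "norm (smul a x) = norm a * norm x"
proof -
  have "(of_real ((norm (smul a x))\<^sup>2) :: 'k) = (a * conjg a) * of_real ((norm x)\<^sup>2)"
    by (simp only: ip_self[symmetric] ip_smul_left ip_smul_right mult.assoc mult.left_commute)
  also have "\<dots> = of_real ((norm a * norm x)\<^sup>2)"
    by (simp add: mult_conjg power_mult_distrib of_real_def)
  finally have "(norm (smul a x))\<^sup>2 = (norm a * norm x)\<^sup>2"
    by (simp only: of_real_eq_iff)
  then show ?thesis by (simp add: power2_eq_iff_nonneg)
qed

text \<open>Induction with the Pythagorean identity: each new term is orthogonal to the sum of the
  others.\<close>

lemma orthonormal_norm_sum:
  assumes f: "orthonormal_basis f" and "finite F"
  shows "(norm (\<Sum>n\<in>F. smul (d n) (f n)))\<^sup>2 = (\<Sum>n\<in>F. (norm (d n))\<^sup>2)"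
  using assms(2)
proof (induction F)
  case empty
  then show ?case by simp
next
  case (insert m F)
  have ipf: "ip (f i) (f j) = (if i = j then 1 else 0)" for i j
    using f by (auto simp: orthonormal_basis_def)
  have "(of_real ((norm (f m))\<^sup>2) :: 'k) = of_real 1"
    using ipf[of m m] by (simp add: ip_self)
  then have "(norm (f m))\<^sup>2 = 1" by (simp only: of_real_eq_iff)
  then have norm_m: "(norm (smul (d m) (f m)))\<^sup>2 = (norm (d m))\<^sup>2"
    by (simp add: norm_smul power_mult_distrib)
  have "ip (\<Sum>n\<in>G. smul (d n) (f n)) (f m) = 0" if "finite G" "m \<notin> G" for G
    using that by (induction G) (auto simp: ip_add_left ip_smul_left ipf)
  then have "ip (smul (d m) (f m)) (\<Sum>n\<in>F. smul (d n) (f n)) = 0"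
    using insert.hyps ip_conjg[of "f m"] by (simp add: ip_smul_left)
  from norm_add_orthogonal[OF this] show ?case
    using insert by (simp add: norm_m)
qed

text \<open>By \<open>orthonormal_norm_sum\<close> the Cauchy criterion for the squares becomes the
  one for the vectors, and \<open>'h\<close> is complete.\<close>

lemma orthonormal_summable:
  assumes f: "orthonormal_basis f" and d: "d \<in> ell2"
  shows "summable (\<lambda>n. smul (d n) (f n))"
  unfolding summable_Cauchy
proof (intro allI impI)
  fix r :: real
  assume r: "r > 0"
  have "summable (\<lambda>n. (norm (d n))\<^sup>2)" using d by (simp add: ell2_def)
  then obtain N where N: "\<And>m n. m \<ge> N \<Longrightarrow> norm (\<Sum>i\<in>{m..<n}. (norm (d i))\<^sup>2) < r\<^sup>2"
    unfolding summable_Cauchy using r by (meson zero_less_power)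
  have "norm (\<Sum>i\<in>{m..<n}. smul (d i) (f i)) < r" if "m \<ge> N" for m n
  proof -
    have "(norm (\<Sum>i\<in>{m..<n}. smul (d i) (f i)))\<^sup>2 < r\<^sup>2"
      using N[OF that, of n] by (simp add: orthonormal_norm_sum[OF f] sum_nonneg)
    then show ?thesis using r by (simp add: power_less_imp_less_base)
  qed
  then show "\<exists>N. \<forall>m\<ge>N. \<forall>n. norm (\<Sum>i\<in>{m..<n}. smul (d i) (f i)) < r" by blast
qed

lemma orthonormal_coeff_le:
  assumes f: "orthonormal_basis f" and d: "d \<in> ell2"
  shows "norm (d n) \<le> norm (\<Sum>n. smul (d n) (f n))"
proof -
  let ?s = "\<lambda>N. \<Sum>n<N. smul (d n) (f n)"
  have lim: "(\<lambda>N. norm (?s N)) \<longlonglongrightarrow> norm (\<Sum>n. smul (d n) (f n))"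
    by (intro tendsto_norm summable_LIMSEQ orthonormal_summable f d)
  have "norm (d n) \<le> norm (?s N)" if "N \<ge> Suc n" for N
  proof -
    have "(norm (d n))\<^sup>2 \<le> (\<Sum>i<N. (norm (d i))\<^sup>2)"
      using that by (intro member_le_sum) auto
    then have "(norm (d n))\<^sup>2 \<le> (norm (?s N))\<^sup>2"
      by (simp add: orthonormal_norm_sum[OF f])
    then show ?thesis by (rule power2_le_imp_le) simp
  qed
  with lim show ?thesis by (intro LIMSEQ_le_const) blast+
qed

lemma riesz_basis_summable:
  assumes "riesz_basis e" and d: "d \<in> ell2"
  shows "summable (\<lambda>n. smul (d n) (e n))"
proof -
  obtain f T where f: "orthonormal_basis f" and T: "bounded_linear T"
    and hom: "\<And>a x. T (smul a x) = smul a (T x)" and e: "\<And>n. e n = T (f n)"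
    using assms(1) unfolding riesz_basis_def by blast
  show ?thesis
    using bounded_linear.summable[OF T orthonormal_summable[OF f d]] by (simp add: hom e)
qed

text \<open>\<open>inv T\<close> carries the series back to the orthonormal expansion with the same
  coefficients, so \<open>C\<close> is a bound for \<open>inv T\<close>.\<close>

lemma riesz_basis_coeff_le:
  assumes "riesz_basis e"
  obtains C where "C > 0"
    and "\<And>d n. d \<in> ell2 \<Longrightarrow> norm (d n) \<le> C * norm (\<Sum>n. smul (d n) (e n))"
proof -
  obtain f T where f: "orthonormal_basis f" and T: "bounded_linear T"
    and hom: "\<And>a x. T (smul a x) = smul a (T x)" and bij: "bij T"
    and inv: "bounded_linear (inv T)" and e: "\<And>n. e n = T (f n)"
    using assms unfolding riesz_basis_def by blast
  obtain C where C: "C > 0" "\<And>x. norm (inv T x) \<le> norm x * C"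
    using bounded_linear.pos_bounded[OF inv] by blast
  show ?thesis
  proof (rule that[OF C(1)])
    fix d :: "nat \<Rightarrow> 'k" and n
    assume d: "d \<in> ell2"
    let ?x = "\<Sum>n. smul (d n) (f n)"
    have "T ?x = (\<Sum>n. smul (d n) (e n))"
      using bounded_linear.suminf[OF T orthonormal_summable[OF f d]] by (simp add: hom e)
    moreover have "inv T (T ?x) = ?x" using bij by (simp add: bij_is_inj)
    ultimately have "norm ?x \<le> C * norm (\<Sum>n. smul (d n) (e n))"
      using C(2)[of "T ?x"] by (simp add: mult.commute)
    with orthonormal_coeff_le[OF f d, of n]
    show "norm (d n) \<le> C * norm (\<Sum>n. smul (d n) (e n))" by linarith
  qed
qed

section \<open>The normed space of formal series and its convergence\<close>

lemma series_norm_triangle: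
  assumes e: "riesz_basis e" and "c \<in> ell2_delta k" "d \<in> ell2_delta k"
  shows "series_norm smul e k (c + d) \<le> series_norm smul e k c + series_norm smul e k d"
proof -
  have s: "summable (\<lambda>n. smul ((delta ^^ k) c n) (e n))"
    "summable (\<lambda>n. smul ((delta ^^ k) d n) (e n))"
    using assms by (auto intro!: riesz_basis_summable simp: ell2_delta_def)
  show ?thesis
    unfolding series_norm_def funpow_delta_add
    by (simp add: scale_left_distrib suminf_add[OF s, symmetric] norm_triangle_ineq)
qed

lemma series_norm_minus_commute: "series_norm smul e k (c - d) = series_norm smul e k (d - c)"
proof -
  have "(\<lambda>n. smul ((delta ^^ k) (c - d) n) (e n)) = (\<lambda>n. - smul ((delta ^^ k) (d - c) n) (e n))"
    by (simp add: funpow_delta_diff flip: scale_minus_left)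
  then show ?thesis by (simp add: series_norm_def norm_suminf_minus)
qed

lemma funpow_delta_le_series_norm:
  assumes "riesz_basis e"
  obtains C where "C > 0"
    and "\<And>c n. c \<in> ell2_delta k \<Longrightarrow> norm ((delta ^^ k) c n) \<le> C * series_norm smul e k c"
  using riesz_basis_coeff_le[OF assms] unfolding series_norm_def ell2_delta_def
  by (metis mem_Collect_eq)

text \<open>For definiteness, a vanishing norm forces all \<open>k\<close>-th differences to vanish,
  and \<open>delta ^^ k\<close> is injective.\<close>

lemma Metric_space_series_norm:
  assumes e: "riesz_basis e"
  shows "Metric_space (ell2_delta k) (\<lambda>c d. series_norm smul e k (c - d))"
proof
  fix c d :: "nat \<Rightarrow> 'k"
  show "0 \<le> series_norm smul e k (c - d)" by (simp add: series_norm_def)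
next
  fix c d :: "nat \<Rightarrow> 'k"
  show "series_norm smul e k (c - d) = series_norm smul e k (d - c)"
    by (rule series_norm_minus_commute)
next
  fix c d :: "nat \<Rightarrow> 'k"
  assume cd: "c \<in> ell2_delta k" "d \<in> ell2_delta k"
  show "series_norm smul e k (c - d) = 0 \<longleftrightarrow> c = d"
  proof
    assume z: "series_norm smul e k (c - d) = 0"
    obtain C where "\<And>c n. c \<in> ell2_delta k \<Longrightarrow> norm ((delta ^^ k) c n) \<le> C * series_norm smul e k c"
      using funpow_delta_le_series_norm[OF e] by metis
    from this[OF ell2_delta_diff[OF cd]] z have "(delta ^^ k) c = (delta ^^ k) d"
      by (auto simp: funpow_delta_diff)
    then show "c = d" using inj_funpow_delta by (metis injD)
  qed (simp add: series_norm_def funpow_delta_0)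
next
  fix c d g :: "nat \<Rightarrow> 'k"
  assume "c \<in> ell2_delta k" "d \<in> ell2_delta k" "g \<in> ell2_delta k"
  then show "series_norm smul e k (c - g) \<le> series_norm smul e k (c - d) + series_norm smul e k (d - g)"
    using series_norm_triangle[OF e, of "c - d" k "d - g"] by (simp add: ell2_delta_diff)
qed

lemma limitin_series_norm_iff:
  assumes e: "riesz_basis e"
  shows "limitin (norm_topology (ell2_delta k) (series_norm smul e k)) c x sequentially \<longleftrightarrow>
    x \<in> ell2_delta k \<and> (\<forall>\<epsilon>>0. \<forall>\<^sub>F i in sequentially. c i \<in> ell2_delta k \<and>
      series_norm smul e k (c i - x) < \<epsilon>)"
  unfolding norm_topology_def by (rule Metric_space.limitin_metric[OF Metric_space_series_norm[OF e]])

text \<open>The threshold on \<open>i\<close> is the same for all \<open>n\<close>. The final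
  contradiction rests on this: a single partial sum must have all differences of its error small at
  once.\<close>

lemma limitin_series_norm_funpow_delta:
  assumes e: "riesz_basis e"
    and lim: "limitin (norm_topology (ell2_delta k) (series_norm smul e k)) c x sequentially"
    and "\<epsilon> > 0"
  shows "\<forall>\<^sub>F i in sequentially. \<forall>n. norm ((delta ^^ k) (c i - x) n) < \<epsilon>"
proof -
  obtain C where C: "C > 0"
    "\<And>c n. c \<in> ell2_delta k \<Longrightarrow> norm ((delta ^^ k) c n) \<le> C * series_norm smul e k c"
    using funpow_delta_le_series_norm[OF e] by metis
  have "\<epsilon> / C > 0" using C(1) \<open>\<epsilon> > 0\<close> by simp
  with lim have x: "x \<in> ell2_delta k"
    and ev: "\<forall>\<^sub>F i in sequentially. c i \<in> ell2_delta k \<and> series_norm smul e k (c i - x) < \<epsilon> / C"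
    by (auto simp: limitin_series_norm_iff[OF e])
  from ev show ?thesis
  proof (rule eventually_mono, intro allI)
    fix i n
    assume i: "c i \<in> ell2_delta k \<and> series_norm smul e k (c i - x) < \<epsilon> / C"
    then have "norm ((delta ^^ k) (c i - x) n) \<le> C * series_norm smul e k (c i - x)"
      using x by (intro C(2) ell2_delta_diff) auto
    also have "\<dots> < \<epsilon>" using i C(1) by (simp add: field_simps)
    finally show "norm ((delta ^^ k) (c i - x) n) < \<epsilon>" .
  qed
qed

lemma limitin_series_norm_coordinate:
  assumes e: "riesz_basis e"
    and lim: "limitin (norm_topology (ell2_delta k) (series_norm smul e k)) c x sequentially"
  shows "(\<lambda>i. c i j) \<longlonglongrightarrow> x j"
proof (rule tendsto_of_funpow_delta[where k = k])
  fix n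
  show "(\<lambda>i. (delta ^^ k) (c i) n) \<longlonglongrightarrow> (delta ^^ k) x n"
  proof (rule tendstoI)
    fix \<epsilon> :: real
    assume "\<epsilon> > 0"
    from limitin_series_norm_funpow_delta[OF e lim this]
    show "\<forall>\<^sub>F i in sequentially. dist ((delta ^^ k) (c i) n) ((delta ^^ k) x n) < \<epsilon>"
      by (rule eventually_mono) (auto simp: funpow_delta_diff dist_norm)
  qed
qed

end

section \<open>Closed spans of unit sequences\<close>

lemma module_seq_scale: "module seq_scale"
  by unfold_locales (auto simp: seq_scale_def fun_eq_iff algebra_simps)

lemma span_unit_seq_support:
  assumes "c \<in> module.span seq_scale (unit_seq ` A)" and "j \<notin> A"
  shows "c j = 0"
proof -
  interpret module seq_scale by (rule module_seq_scale)
  have "subspace {c. c j = 0}"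
    by (auto simp: subspace_def seq_scale_def)
  moreover have "unit_seq ` A \<subseteq> {c. c j = 0}"
    using assms(2) by (auto simp: unit_seq_def)
  ultimately show ?thesis using span_minimal assms(1) by blast
qed

text \<open>Coordinates are continuous for the series norm, so vanishing at \<open>j\<close> passes
  from the span to its closure.\<close>

lemma (in hilbert_space) closed_lin_unit_seq_support:
  assumes e: "riesz_basis e"
    and c: "c \<in> closed_lin seq_scale (ell2_delta k) (series_norm smul e k) (unit_seq ` A)"
    and "j \<notin> A"
  shows "c j = 0"
proof -
  obtain \<sigma> where \<sigma>: "range \<sigma> \<subseteq> module.span seq_scale (unit_seq ` A)"
    and lim: "limitin (norm_topology (ell2_delta k) (series_norm smul e k)) \<sigma> c sequentially"
    using c Metric_space.closure_of_sequentially[OF Metric_space_series_norm[OF e]]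
    unfolding closed_lin_def norm_topology_def by auto
  have "\<sigma> i j = 0" for i
    using \<sigma> by (intro span_unit_seq_support[OF _ \<open>j \<notin> A\<close>]) auto
  then show ?thesis
    using limitin_series_norm_coordinate[OF e lim, of j] by (simp add: LIMSEQ_const_iff)
qed

lemma sum_fun_apply: "(\<Sum>i\<in>F. y i) j = (\<Sum>i\<in>F. y i j)"
  by (induction F rule: infinite_finite_induct) auto

theorem theorem2p1:
  fixes smul :: "'k::rc_scalar \<Rightarrow> 'h::banach \<Rightarrow> 'h"
    and ip :: "'h \<Rightarrow> 'h \<Rightarrow> 'k"
    and e :: "nat \<Rightarrow> 'h"
    and k :: nat
    and A :: "nat \<Rightarrow> nat set"
  assumes "hilbert_space smul ip"
    and "hilbert_space.riesz_basis smul ip e"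
    and "k \<ge> 1"
    and "\<And>n. A n \<noteq> {}"
    and "(\<Union>n. A n) = UNIV"
    and "\<And>m n. m \<noteq> n \<Longrightarrow> A m \<inter> A n = {}"
  shows "\<not> schauder_decomposition seq_scale (ell2_delta k) (series_norm smul e k)
           (\<lambda>n. closed_lin seq_scale (ell2_delta k) (series_norm smul e k) (unit_seq ` A n))"
proof
  interpret hilbert_space smul ip by fact
  note e = assms(2)
  assume "schauder_decomposition seq_scale (ell2_delta k) (series_norm smul e k)
           (\<lambda>n. closed_lin seq_scale (ell2_delta k) (series_norm smul e k) (unit_seq ` A n))"
  then obtain y :: "nat \<Rightarrow> nat \<Rightarrow> 'k"
    where y: "\<And>n. y n \<in> closed_lin seq_scale (ell2_delta k) (series_norm smul e k) (unit_seq ` A n)"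
      and lim: "limitin (norm_topology (ell2_delta k) (series_norm smul e k))
        (\<lambda>N. \<Sum>n<N. y n) (\<lambda>_. 1) sequentially"
    using const_1_in_ell2_delta[OF assms(3)] unfolding schauder_decomposition_def by blast
  have partial_sum: "(\<Sum>n<N. y n) j = (if m < N then y m j else 0)" if j: "j \<in> A m" for N m j
  proof -
    \<comment> \<open>By disjointness \<open>j\<close> lies outside \<open>A n\<close> for
      \<open>n\<close> other than \<open>m\<close>, where the support lemma gives
      \<open>0\<close>.\<close>
    have "y n j = (if n = m then y m j else 0)" for n
      using closed_lin_unit_seq_support[OF e y, of j n] assms(6)[of n m] j by auto
    then have "(\<Sum>n<N. y n j) = (\<Sum>n<N. if n = m then y m j else 0)" by (intro sum.cong) auto
    then show ?thesis by (simp add: sum_fun_apply)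
  qed
  have indicator: "y m j = 1" if j: "j \<in> A m" for m j
  proof -
    \<comment> \<open>At a fixed position the partial sums are constant once \<open>N\<close>
      exceeds \<open>m\<close>, while they must converge to \<open>1\<close>.\<close>
    have "\<forall>\<^sub>F N in sequentially. (\<Sum>n<N. y n) j = y m j"
      using eventually_gt_at_top[of m] by eventually_elim (simp add: partial_sum[OF j])
    then have "(\<lambda>N. (\<Sum>n<N. y n) j) \<longlonglongrightarrow> y m j" by (rule tendsto_eventually)
    from LIMSEQ_unique[OF this limitin_series_norm_coordinate[OF e lim]] show ?thesis .
  qed
  \<comment> \<open>The radius \<open>1\<close> is the least modulus of a nonzero integer; any
    \<open>N\<close> that is good for all \<open>n\<close> will do.\<close>
  have "\<exists>N. \<forall>n. norm ((delta ^^ k) ((\<Sum>n<N. y n) - (\<lambda>_. 1)) n) < 1"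
    by (rule eventually_happens'[OF sequentially_bot
          limitin_series_norm_funpow_delta[OF e lim zero_less_one]])
  then obtain N where N: "norm ((delta ^^ k) ((\<Sum>n<N. y n) - (\<lambda>_. 1)) n) < 1" for n by blast
  let ?r = "(\<Sum>n<N. y n) - (\<lambda>_. 1)"
  \<comment> \<open>The entry is \<open>0\<close> on the sets \<open>A m\<close> with
    \<open>m < N\<close> and \<open>-1\<close> on the remaining ones.\<close>
  have "?r j \<in> \<int>" for j
  proof -
    obtain m where "j \<in> A m" using assms(5) by blast
    then show ?thesis by (simp add: partial_sum indicator)
  qed
  then have "(delta ^^ k) ?r n \<in> \<int>" for n by (rule funpow_delta_Ints)
  with N have "(delta ^^ k) ?r n = 0" for n using norm_Ints_ge_1 by (meson not_le)
  then have "(delta ^^ k) ?r = (delta ^^ k) 0" by (auto simp: funpow_delta_0)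
  then have r: "?r = 0" using inj_funpow_delta by (metis injD)
  \<comment> \<open>The sum over \<open>n < N\<close> stops just before index \<open>N\<close>, so
    the remainder cannot vanish on the nonempty set \<open>A N\<close>.\<close>
  obtain j where "j \<in> A N" using assms(4) by blast
  then have "?r j = - 1" by (simp add: partial_sum)
  with r show False by simp
qed

end
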